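(* Let $\alpha,\beta\in[0,2\pi)$, $s=\sin(\alpha+\beta)\neq0$, $r=\sin(\alpha-\beta)$ with $0<|r|<1$. Let $g$ be the density of the limit distribution, $C_0=\int_{-\infty}^{\infty}g(y)\,dy$, and $v(k)=d\theta_0(k)/dk$ the group velocity of the edge state. Then the group velocity $v(k)$ satisfies $$g(v(k))\,\frac{dv(k)}{dk}=\frac{2s^2/r^2}{\pi}\,v^2(k),$$ $$\int_0^{2\pi}|v(k)|\,\frac{dk}{2\pi}=\frac{2\arcsin|r|}{\pi}.$$ Here $s^2$ is expressed as $$s^2=\frac{r^2}{1-\sqrt{1-r^2}}\,C_0 .$$
   Context: For $k\in[0,2\pi)$, $$\theta_0(k)=\begin{cases}\arcsin(-r\sin k)&\text{if } s\cos k\le0,\\ \pi-\arcsin(-r\sin k)&\text{if } s\cos k>0.\end{cases}$$ The density of the limit distribution is $$g(y)=\frac{2s^2}{r^2}y^2f_K(y;|r|)\times\begin{cases}\mathbf{1}_{[0,\infty)}(y)&\text{if } sr>0,\\ \mathbf{1}_{(-\infty,0]}(y)&\text{if } sr<0,\end{cases}\qquad f_K(x;p)=\frac{\sqrt{1-p^2}}{\pi(1-x^2)\sqrt{p^2-x^2}}\,\mathbf{1}_{(-p,p)}(x)\quad(0<p<1).$$ (It is the density of the limit, after rescaling by time, of the finding probability on the boundary self-loops of the associated two-dimensional quantum walk with parameters $(\alpha,\beta)$.)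
   Formalization: The first identity fails as printed where v decreases and where sin k = 0; v does not exist where cos k = 0. It is proved with |dv/dk| for sin k cos k ≠ 0: verbatim where v increases (sr sin 2k < 0), with a minus sign where v decreases. *)

theory Defs
  imports "HOL-Analysis.Analysis"
begin

(* The case formula is 2 pi-periodic in k, so it is used on all of the reals; this makes the
   two-sided derivative at k = 0 the natural one. *)
definition theta0 :: "real \<Rightarrow> real \<Rightarrow> real \<Rightarrow> real" where
  "theta0 s r k = (if s * cos k \<le> 0 then arcsin (- r * sin k) else pi - arcsin (- r * sin k))"

(* theta0 jumps where cos k = 0, so at those points deriv is an unspecified value. *)
definition group_velocity :: "real \<Rightarrow> real \<Rightarrow> real \<Rightarrow> real" where
  "group_velocity s r = deriv (theta0 s r)"

definition f_K :: "real \<Rightarrow> real \<Rightarrow> real" where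
  "f_K x p = sqrt (1 - p\<^sup>2) / (pi * (1 - x\<^sup>2) * sqrt (p\<^sup>2 - x\<^sup>2)) * indicat_real {-p<..<p} x"

definition limit_density :: "real \<Rightarrow> real \<Rightarrow> real \<Rightarrow> real" where
  "limit_density s r y =
     2 * s\<^sup>2 / r\<^sup>2 * y\<^sup>2 * f_K y \<bar>r\<bar> *
     (if s * r > 0 then indicat_real {0..} y
      else if s * r < 0 then indicat_real {..0} y
      else 0)"

end

theory Submission
  imports Defs
begin

text \<open>On either branch, \<open>theta0\<close> is a constant plus or minus \<open>arcsin (r * sin k)\<close>, so
  \<open>\<bar>v k\<bar> = \<bar>r\<bar> * \<bar>cos k\<bar> / D\<close> with \<open>D\<^sup>2 = 1 - r\<^sup>2 * (sin k)\<^sup>2\<close>, and the sign of \<open>v\<close> is that of \<open>s * r\<close>.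
  Then \<open>1 - v\<^sup>2 = (1 - r\<^sup>2) / D\<^sup>2\<close> and \<open>r\<^sup>2 - v\<^sup>2 = r\<^sup>2 * (1 - r\<^sup>2) * (sin k)\<^sup>2 / D\<^sup>2\<close>, so \<open>f_K (v k) \<bar>r\<bar>\<close> is
  the reciprocal of \<open>pi * \<bar>deriv v k\<bar>\<close>. The constant \<open>C\<^sub>0\<close> comes from an explicit antiderivative of
  the density that extends continuously to the end points \<open>\<plusminus>\<bar>r\<bar>\<close>.\<close>

section \<open>Derivatives of the edge-state phase and of its group velocity\<close>

lemma one_minus_r_sin_pos:
  fixes r k :: real
  assumes "\<bar>r\<bar> < 1"
  shows "0 < 1 - r\<^sup>2 * (sin k)\<^sup>2"
proof -
  have "\<bar>r * sin k\<bar> < 1"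
    using assms abs_sin_le_one[of k] mult_left_le[of "\<bar>sin k\<bar>" "\<bar>r\<bar>"] by (simp add: abs_mult)
  then show ?thesis
    by (simp add: abs_square_less_1 flip: power_mult_distrib)
qed

text \<open>Kept relative to a set \<open>S\<close> because it serves two purposes: the two-sided
  derivative of \<open>theta0\<close>, and antiderivatives on closed intervals when the mean speed
  is computed.\<close>

lemma has_derivative_arcsin_mult_sin:
  fixes c k :: real
  assumes "\<bar>c\<bar> < 1"
  shows "((\<lambda>x. arcsin (c * sin x)) has_real_derivative
           c * cos k / sqrt (1 - c\<^sup>2 * (sin k)\<^sup>2)) (at k within S)"
proof -
  have "0 < 1 - (c * sin k)\<^sup>2"
    using one_minus_r_sin_pos[OF assms] by (simp add: power_mult_distrib)
  then have "\<bar>c * sin k\<bar> < 1"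
    by (simp only: abs_square_less_1 diff_gt_0_iff_gt)
  then have "- 1 < c * sin k" "c * sin k < 1" by linarith+
  moreover have "((\<lambda>x. c * sin x) has_real_derivative c * cos k) (at k within S)"
    by (auto intro!: derivative_eq_intros)
  ultimately have "((\<lambda>x. arcsin (c * sin x)) has_real_derivative
      inverse (sqrt (1 - (c * sin k)\<^sup>2)) * (c * cos k)) (at k within S)"
    by (intro DERIV_chain2[where f = arcsin] DERIV_arcsin)
  then show ?thesis
    by (simp add: power_mult_distrib divide_inverse mult.commute)
qed

text \<open>With \<open>c = cos k\<close> nonzero this is an open neighbourhood of \<open>k\<close>
  on which the cosine keeps its sign, so \<open>theta0\<close> does not change branch there.\<close>

lemma open_same_sign_cos: "open {x::real. 0 < cos x * c}"
  by (intro open_Collect_less continuous_intros)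

lemma theta0_has_derivative:
  assumes "\<bar>r\<bar> < 1" "s \<noteq> 0" "cos k \<noteq> 0"
  shows "(theta0 s r has_real_derivative
           sgn (s * cos k) * (r * cos k / sqrt (1 - r\<^sup>2 * (sin k)\<^sup>2))) (at k)"
proof (rule has_field_derivative_transform_within_open[OF _ open_same_sign_cos[of "cos k"]])
  \<comment> \<open>The offset \<open>?c\<close> and the factor \<open>- sgn (s * cos k)\<close>,
    both frozen at \<open>k\<close>, merge the two branches of \<open>theta0\<close> into one
    differentiable expression.\<close>
  let ?c = "if s * cos k \<le> 0 then 0 else pi"
  let ?D = "sqrt (1 - r\<^sup>2 * (sin k)\<^sup>2)"
  have "((\<lambda>x. arcsin (- r * sin x)) has_real_derivative - (r * cos k / ?D)) (at k)"
    using has_derivative_arcsin_mult_sin[of "- r" k UNIV] assms(1) by simp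
  from DERIV_diff[OF DERIV_const[of ?c] DERIV_cmult[OF this, of "sgn (s * cos k)"]]
  show "((\<lambda>x. ?c - sgn (s * cos k) * arcsin (- r * sin x)) has_real_derivative
      sgn (s * cos k) * (r * cos k / ?D)) (at k)"
    by (simp only: diff_0 mult_minus_right minus_minus)
  show "k \<in> {x. 0 < cos x * cos k}"
    using assms(3) by (simp flip: power2_eq_square)
  show "?c - sgn (s * cos k) * arcsin (- r * sin x) = theta0 s r x" if "x \<in> {x. 0 < cos x * cos k}" for x
    using that assms
    by (auto simp: theta0_def zero_less_mult_iff mult_le_0_iff sgn_if mult_less_0_iff)
qed

lemma group_velocity_eq:
  assumes "\<bar>r\<bar> < 1" "s \<noteq> 0" "cos k \<noteq> 0"
  shows "group_velocity s r k = sgn (s * cos k) * (r * cos k / sqrt (1 - r\<^sup>2 * (sin k)\<^sup>2))"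
  unfolding group_velocity_def by (rule DERIV_imp_deriv[OF theta0_has_derivative[OF assms]])

lemma group_velocity_has_derivative:
  assumes "\<bar>r\<bar> < 1" "s \<noteq> 0" "cos k \<noteq> 0"
  shows "(group_velocity s r has_real_derivative
           - (sgn (s * cos k) * r * sin k * (1 - r\<^sup>2) / sqrt (1 - r\<^sup>2 * (sin k)\<^sup>2) ^ 3)) (at k)"
proof (rule has_field_derivative_transform_within_open[OF _ open_same_sign_cos[of "cos k"]])
  let ?D2 = "1 - r\<^sup>2 * (sin k)\<^sup>2"
  let ?w = "\<lambda>x. r * cos x / sqrt (1 - r\<^sup>2 * (sin x)\<^sup>2)"
  have pos: "0 < ?D2" by (rule one_minus_r_sin_pos[OF assms(1)])
  \<comment> \<open>Since \<open>sin\<close> and \<open>cos\<close> have squares summing to 1, the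
    bracket left by the quotient rule collapses to \<open>r\<^sup>2 - 1\<close>.\<close>
  have num: "r * sin k * (r\<^sup>2 * (cos k)\<^sup>2 - ?D2) = - (r * sin k * (1 - r\<^sup>2))"
    by (simp add: cos_squared_eq algebra_simps)
  have "(?w has_real_derivative
      r * sin k * (r\<^sup>2 * (cos k)\<^sup>2 - ?D2) / sqrt ?D2 ^ 3) (at k)"
    using pos
    by (auto intro!: derivative_eq_intros
        simp: divide_simps power3_eq_cube power2_eq_square algebra_simps)
  then have "(?w has_real_derivative - (r * sin k * (1 - r\<^sup>2) / sqrt ?D2 ^ 3)) (at k)"
    by (simp only: num minus_divide_left)
  from DERIV_cmult[OF this, of "sgn (s * cos k)"]
  show "((\<lambda>x. sgn (s * cos k) * ?w x) has_real_derivative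
      - (sgn (s * cos k) * r * sin k * (1 - r\<^sup>2) / sqrt ?D2 ^ 3)) (at k)"
    by (simp add: mult.assoc)
  show "k \<in> {x. 0 < cos x * cos k}"
    using assms(3) by (simp flip: power2_eq_square)
  show "sgn (s * cos k) * ?w x = group_velocity s r x" if "x \<in> {x. 0 < cos x * cos k}" for x
  proof -
    have "sgn (cos x) = sgn (cos k)" "cos x \<noteq> 0"
      using that by (auto simp: zero_less_mult_iff)
    then show ?thesis
      by (simp add: group_velocity_eq[OF assms(1,2)] sgn_mult)
  qed
qed

section \<open>The density evaluated along the group velocity\<close>

lemma abs_group_velocity:
  assumes "\<bar>r\<bar> < 1" "s \<noteq> 0" "cos k \<noteq> 0"
  shows "\<bar>group_velocity s r k\<bar> = \<bar>r\<bar> * \<bar>cos k\<bar> / sqrt (1 - r\<^sup>2 * (sin k)\<^sup>2)"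
  using assms one_minus_r_sin_pos[OF assms(1), of k]
  by (simp add: group_velocity_eq abs_mult abs_sgn_eq)

text \<open>Where \<open>v\<close> is monotone, the substitution \<open>y = v k\<close> turns
  \<open>f_K y \<bar>r\<bar> dy\<close> into the uniform measure \<open>dk / pi\<close>. The
  condition on \<open>sin k\<close> keeps \<open>\<bar>v k\<bar>\<close> strictly below
  \<open>\<bar>r\<bar>\<close>, where the indicator in \<open>f_K\<close> is 1.\<close>

lemma f_K_group_velocity:
  assumes "0 < \<bar>r\<bar>" "\<bar>r\<bar> < 1" "s \<noteq> 0" "sin k \<noteq> 0" "cos k \<noteq> 0"
  shows "f_K (group_velocity s r k) \<bar>r\<bar> * \<bar>deriv (group_velocity s r) k\<bar> = 1 / pi"
proof -
  define D where "D = sqrt (1 - r\<^sup>2 * (sin k)\<^sup>2)"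
  define v where "v = group_velocity s r k"
  define q where "q = sqrt (1 - r\<^sup>2)"
  have D: "0 < D" "D\<^sup>2 = 1 - r\<^sup>2 * (sin k)\<^sup>2"
    using one_minus_r_sin_pos[OF assms(2), of k] by (auto simp: D_def)
  have "r\<^sup>2 < 1" using assms by (simp add: abs_square_less_1)
  then have q: "0 < q" "q\<^sup>2 = 1 - r\<^sup>2" by (auto simp: q_def)
  have v_abs: "\<bar>v\<bar> = \<bar>r\<bar> * \<bar>cos k\<bar> / D"
    unfolding v_def D_def using assms by (intro abs_group_velocity)
  then have "v\<^sup>2 = (\<bar>r\<bar> * \<bar>cos k\<bar> / D)\<^sup>2" by (metis power2_abs)
  then have v2: "v\<^sup>2 = r\<^sup>2 * (cos k)\<^sup>2 / D\<^sup>2" by (simp add: power_divide power_mult_distrib)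
  have a: "1 - v\<^sup>2 = q\<^sup>2 / D\<^sup>2"
    using D unfolding v2 q by (simp add: field_simps cos_squared_eq)
  have b: "\<bar>r\<bar>\<^sup>2 - v\<^sup>2 = (\<bar>r\<bar> * \<bar>sin k\<bar> * q / D)\<^sup>2"
  proof -
    have "r\<^sup>2 - v\<^sup>2 = r\<^sup>2 * (D\<^sup>2 - (cos k)\<^sup>2) / D\<^sup>2"
      using D(1) unfolding v2 by (simp add: field_simps)
    also have "D\<^sup>2 - (cos k)\<^sup>2 = (sin k)\<^sup>2 * q\<^sup>2"
      unfolding D q by (simp add: cos_squared_eq algebra_simps)
    finally show ?thesis by (simp add: power_divide power_mult_distrib)
  qed
  have "0 < \<bar>r\<bar>\<^sup>2 - v\<^sup>2" unfolding b using assms q D by simp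
  then have "\<bar>v\<bar> < \<bar>r\<bar>" using abs_le_square_iff[of r v] by simp
  then have ind: "v \<in> {- \<bar>r\<bar><..<\<bar>r\<bar>}" by auto
  have s: "sqrt (\<bar>r\<bar>\<^sup>2 - v\<^sup>2) = \<bar>r\<bar> * \<bar>sin k\<bar> * q / D"
    unfolding b real_sqrt_abs using q D by (simp add: abs_mult)
  have d: "\<bar>deriv (group_velocity s r) k\<bar> = \<bar>r\<bar> * \<bar>sin k\<bar> * q\<^sup>2 / D ^ 3"
    unfolding DERIV_imp_deriv[OF group_velocity_has_derivative[OF assms(2,3,5)]]
    using assms D q by (simp add: abs_mult abs_sgn_eq flip: D_def q(2))
  have "f_K v \<bar>r\<bar> = q / (pi * (q\<^sup>2 / D\<^sup>2) * (\<bar>r\<bar> * \<bar>sin k\<bar> * q / D))"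
    unfolding f_K_def s a using ind by (simp add: q_def)
  then show ?thesis
    unfolding d v_def[symmetric] using q(1) D(1) assms(1,4)
    by (simp add: field_simps power2_eq_square power3_eq_cube)
qed

lemma limit_density_group_velocity:
  assumes "0 < \<bar>r\<bar>" "\<bar>r\<bar> < 1" "s \<noteq> 0" "sin k \<noteq> 0" "cos k \<noteq> 0"
  shows "limit_density s r (group_velocity s r k) * \<bar>deriv (group_velocity s r) k\<bar>
           = (2 * s\<^sup>2 / r\<^sup>2) / pi * (group_velocity s r k)\<^sup>2"
proof -
  \<comment> \<open>Absorbing the sign of \<open>cos k\<close> into its absolute value leaves a
    positive factor \<open>c\<close>. Hence \<open>v\<close> has the sign of \<open>s * r\<close>
    and lies in the half-line kept by the density.\<close>
  define c where "c = \<bar>cos k\<bar> / sqrt (1 - r\<^sup>2 * (sin k)\<^sup>2)"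
  have v: "group_velocity s r k = sgn s * r * c"
    using assms by (simp add: c_def group_velocity_eq sgn_mult abs_sgn mult_ac)
  have c: "0 < c"
    using assms one_minus_r_sin_pos[of r k] by (simp add: c_def)
  have "(if s * r > 0 then indicat_real {0..} (group_velocity s r k)
      else if s * r < 0 then indicat_real {..0} (group_velocity s r k) else 0) = 1"
    using c assms(1,3) unfolding v
    by (cases "s > 0"; cases "r > 0")
       (auto simp: zero_less_mult_iff mult_less_0_iff mult_le_0_iff zero_le_mult_iff
         split: split_indicator)
  then have "limit_density s r (group_velocity s r k) =
      2 * s\<^sup>2 / r\<^sup>2 * (group_velocity s r k)\<^sup>2 * f_K (group_velocity s r k) \<bar>r\<bar>"
    by (simp only: limit_density_def mult_1_right)
  then show ?thesis
    using f_K_group_velocity[OF assms] by (simp add: mult.assoc)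
qed

text \<open>The derivative is a positive multiple of \<open>- sgn (s * cos k) * r * sin k\<close>,
  and \<open>sin k * cos k\<close> is half of \<open>sin (2 * k)\<close>.\<close>

lemma sgn_deriv_group_velocity:
  assumes "\<bar>r\<bar> < 1" "s \<noteq> 0" "cos k \<noteq> 0"
  shows "sgn (deriv (group_velocity s r) k) = - sgn (s * r * sin (2 * k))"
proof -
  have "r\<^sup>2 < 1" using assms by (simp add: abs_square_less_1)
  then show ?thesis
    unfolding DERIV_imp_deriv[OF group_velocity_has_derivative[OF assms]]
    using one_minus_r_sin_pos[OF assms(1), of k]
    by (simp add: sgn_mult sgn_divide sin_double power3_eq_cube)
qed

section \<open>The mean speed over one period\<close>

text \<open>The period is cut at the zeros of the cosine. On each piece
  \<open>arcsin (\<bar>r\<bar> * sin k)\<close> or its negative is an antiderivative, and every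
  quarter period contributes \<open>arcsin \<bar>r\<bar>\<close>.\<close>

lemma has_integral_abs_cos:
  fixes r :: real
  assumes "\<bar>r\<bar> < 1"
  shows "((\<lambda>k. \<bar>r\<bar> * \<bar>cos k\<bar> / sqrt (1 - r\<^sup>2 * (sin k)\<^sup>2)) has_integral 4 * arcsin \<bar>r\<bar>) {0..2 * pi}"
proof -
  let ?h = "\<lambda>k. \<bar>r\<bar> * \<bar>cos k\<bar> / sqrt (1 - r\<^sup>2 * (sin k)\<^sup>2)"
  have F: "((\<lambda>k. arcsin (\<bar>r\<bar> * sin k)) has_real_derivative
      \<bar>r\<bar> * cos k / sqrt (1 - r\<^sup>2 * (sin k)\<^sup>2)) (at k within S)" for k S
    using has_derivative_arcsin_mult_sin[of "\<bar>r\<bar>" k S] assms by simp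
  have pos: "(?h has_integral arcsin (\<bar>r\<bar> * sin b) - arcsin (\<bar>r\<bar> * sin a)) {a..b}"
    if "a \<le> b" "\<And>x. x \<in> {a..b} \<Longrightarrow> 0 \<le> cos x" for a b
    using that F
    by (intro fundamental_theorem_of_calculus)
       (auto simp flip: has_real_derivative_iff_has_vector_derivative)
  have neg: "(?h has_integral - arcsin (\<bar>r\<bar> * sin b) - - arcsin (\<bar>r\<bar> * sin a)) {a..b}"
    if "a \<le> b" "\<And>x. x \<in> {a..b} \<Longrightarrow> cos x \<le> 0" for a b
    using that DERIV_minus[OF F]
    by (intro fundamental_theorem_of_calculus)
       (auto simp flip: has_real_derivative_iff_has_vector_derivative)
  have sin32: "sin (3 * pi / 2) = - 1"
    using sin_3over2_pi by (simp add: mult.commute)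
  have 1: "(?h has_integral arcsin \<bar>r\<bar>) {0..pi / 2}"
    using pos[of 0 "pi / 2"] cos_ge_zero by simp
  have 2: "(?h has_integral 2 * arcsin \<bar>r\<bar>) {pi / 2..3 * pi / 2}"
  proof -
    have "cos x \<le> 0" if "x \<in> {pi / 2..3 * pi / 2}" for x
      using that cos_ge_zero[of "x - pi"] by (simp add: cos_diff)
    with neg[of "pi / 2" "3 * pi / 2"] show ?thesis
      using assms by (simp add: sin32 arcsin_minus)
  qed
  have 3: "(?h has_integral arcsin \<bar>r\<bar>) {3 * pi / 2..2 * pi}"
  proof -
    have "0 \<le> cos x" if "x \<in> {3 * pi / 2..2 * pi}" for x
      using that cos_ge_zero[of "x - 2 * pi"] by (simp add: cos_diff)
    with pos[of "3 * pi / 2" "2 * pi"] show ?thesis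
      using assms by (simp add: sin32 arcsin_minus)
  qed
  have "(?h has_integral arcsin \<bar>r\<bar> + 2 * arcsin \<bar>r\<bar>) {0..3 * pi / 2}"
    by (rule has_integral_combine[OF _ _ 1 2]) auto
  from has_integral_combine[OF _ _ this 3] show ?thesis by simp
qed

text \<open>The speed agrees with the continuous function \<open>?h\<close> except at the jumps of
  \<open>theta0\<close>, where \<open>deriv\<close> is unspecified. Only two such points lie in the
  interval, and a finite set affects neither integrability nor the integral.\<close>

lemma abs_group_velocity_integral:
  assumes "\<bar>r\<bar> < 1" "s \<noteq> 0"
  shows "set_integrable lborel {0..2 * pi} (\<lambda>k. \<bar>group_velocity s r k\<bar> / (2 * pi))"
    and "(LINT k:{0..2 * pi}|lborel. \<bar>group_velocity s r k\<bar> / (2 * pi)) = 2 * arcsin \<bar>r\<bar> / pi"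
proof -
  let ?h = "\<lambda>k. \<bar>r\<bar> * \<bar>cos k\<bar> / sqrt (1 - r\<^sup>2 * (sin k)\<^sup>2)"
  let ?X = "{pi / 2, 3 * pi / 2}"
  have h_int: "set_integrable lborel {0..2 * pi} (\<lambda>k. ?h k / (2 * pi))"
    using one_minus_r_sin_pos[OF assms(1)]
    by (intro borel_integrable_atLeastAtMost' continuous_intros) (auto simp: less_imp_neq[symmetric])
  have "((\<lambda>k. ?h k / (2 * pi)) has_integral 2 * arcsin \<bar>r\<bar> / pi) {0..2 * pi}"
    using has_integral_divide[OF has_integral_abs_cos[OF assms(1)], of "2 * pi"] by simp
  then have h_eq: "(LINT k:{0..2 * pi}|lborel. ?h k / (2 * pi)) = 2 * arcsin \<bar>r\<bar> / pi"
    unfolding set_borel_integral_eq_integral(2)[OF h_int] by (simp only: integral_unique)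
  have eq: "indicat_real {0..2 * pi} k *\<^sub>R (\<bar>group_velocity s r k\<bar> / (2 * pi)) =
      indicat_real {0..2 * pi} k *\<^sub>R (?h k / (2 * pi))" if "k \<notin> ?X" for k
  proof (cases "k \<in> {0..2 * pi}")
    case True
    have "cos k \<noteq> 0"
    proof
      assume "cos k = 0"
      then obtain i where i: "odd i" "k = of_int i * (pi / 2)"
        unfolding cos_zero_iff_int by blast
      \<comment> \<open>The end points 0 and \<open>2 * pi\<close> are written as multiples of
        \<open>pi / 2\<close> so that this factor cancels. The odd values between 0 and 4 are 1 and
        3, which are exactly the points of \<open>?X\<close>.\<close>
      then have *: "0 * (pi / 2) \<le> of_int i * (pi / 2)" "of_int i * (pi / 2) \<le> 4 * (pi / 2)"
        using True i(2) by simp_all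
      have "0 \<le> real_of_int i" "real_of_int i \<le> 4"
        using mult_right_le_imp_le[OF *(1)] mult_right_le_imp_le[OF *(2)] by simp_all
      then have "0 \<le> i" "i \<le> 4" by simp_all
      with i(1) have "i = 1 \<or> i = 3" by presburger
      with i(2) that show False by auto
    qed
    then show ?thesis using assms by (simp add: abs_group_velocity)
  qed simp
  show "set_integrable lborel {0..2 * pi} (\<lambda>k. \<bar>group_velocity s r k\<bar> / (2 * pi))"
    using h_int integrable_discrete_difference[of ?X lborel, OF _ _ _ eq]
    unfolding set_integrable_def by simp
  show "(LINT k:{0..2 * pi}|lborel. \<bar>group_velocity s r k\<bar> / (2 * pi)) = 2 * arcsin \<bar>r\<bar> / pi"
    using h_eq integral_discrete_difference[of ?X lborel, OF _ _ _ eq]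
    unfolding set_lebesgue_integral_def by simp
qed

section \<open>The total mass of the limit density\<close>

text \<open>Passes from gauge to Lebesgue integrals, which for nonnegative Borel functions have the
  same value. It is used for the density, which is unbounded near one end of its support.\<close>

lemma has_bochner_integral_lborel_nonneg:
  fixes f :: "real \<Rightarrow> real"
  assumes "f \<in> borel_measurable borel" "\<And>x. 0 \<le> f x" "(f has_integral I) UNIV"
  shows "has_bochner_integral lborel f I"
proof (rule has_bochner_integral_nn_integral)
  show "0 \<le> I" using assms(2) by (intro has_integral_nonneg[OF assms(3)])
  show "(\<integral>\<^sup>+x. ennreal (f x) \<partial>lborel) = ennreal I"
    by (rule nn_integral_has_integral_lborel) (use assms in auto)
qed (use assms in auto)

text \<open>The odd antiderivative of \<open>y\<^sup>2 * f_K y p\<close> on the open support.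
  Writing \<open>y\<^sup>2 = 1 - (1 - y\<^sup>2)\<close> splits that integrand into
  \<open>f_K\<close> itself, whose distribution function is the first term up to a constant, and a
  multiple of the arcsine density, which gives the second term.\<close>

definition f_K_moment2 :: "real \<Rightarrow> real \<Rightarrow> real" where
  "f_K_moment2 p x =
     (arcsin (sqrt (1 - p\<^sup>2) * x / (p * sqrt (1 - x\<^sup>2))) - sqrt (1 - p\<^sup>2) * arcsin (x / p)) / pi"

lemma f_K_moment2_has_derivative:
  fixes p y :: real
  assumes "0 < p" "p < 1" "- p < y" "y < p"
  shows "(f_K_moment2 p has_real_derivative y\<^sup>2 * f_K y p) (at y)"
proof -
  define q where "q = sqrt (1 - p\<^sup>2)"
  define E where "E = sqrt (1 - y\<^sup>2)"
  define R where "R = sqrt (p\<^sup>2 - y\<^sup>2)"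
  have yp: "y\<^sup>2 < p\<^sup>2" using assms abs_le_square_iff[of p y] by auto
  have p1: "p\<^sup>2 < 1" using assms by (simp add: power_less_one_iff)
  have q: "0 < q" "q\<^sup>2 = 1 - p\<^sup>2" using p1 by (auto simp: q_def)
  have E: "0 < E" "E\<^sup>2 = 1 - y\<^sup>2" using p1 yp by (auto simp: E_def)
  have R: "0 < R" "R\<^sup>2 = p\<^sup>2 - y\<^sup>2" using yp by (auto simp: R_def)
  \<comment> \<open>This identity makes the radicand in the derivative of the first
    \<open>arcsin\<close> a perfect square. The same root \<open>R\<close> occurs in the second one,
    so the two terms can be combined.\<close>
  have "p\<^sup>2 * E\<^sup>2 - q\<^sup>2 * y\<^sup>2 = R\<^sup>2"
    unfolding q E R by (simp add: algebra_simps)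
  moreover have "1 - (q * y / (p * E))\<^sup>2 = (p\<^sup>2 * E\<^sup>2 - q\<^sup>2 * y\<^sup>2) / (p * E)\<^sup>2"
    using assms E(1) by (simp add: power_divide power_mult_distrib diff_divide_distrib)
  ultimately have a: "1 - (q * y / (p * E))\<^sup>2 = (R / (p * E))\<^sup>2"
    by (simp add: power_divide)
  have b: "1 - (y / p)\<^sup>2 = (R / p)\<^sup>2"
    using assms by (simp add: power_divide R field_simps)
  have "0 < 1 - (q * y / (p * E))\<^sup>2" unfolding a using assms R E by simp
  then have "\<bar>q * y / (p * E)\<bar> < 1" by (simp only: abs_square_less_1 diff_gt_0_iff_gt)
  then have a': "- 1 < q * y / (p * E)" "q * y / (p * E) < 1" by linarith+
  have sa: "sqrt (1 - (q * y / (p * E))\<^sup>2) = R / (p * E)"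
    unfolding a real_sqrt_abs using assms R E by simp
  have sb: "sqrt (1 - (y / p)\<^sup>2) = R / p"
    unfolding b real_sqrt_abs using assms R by simp
  have b': "- 1 < y / p" "y / p < 1" using assms by (auto simp: field_simps)
  have "((\<lambda>x. sqrt (1 - x\<^sup>2)) has_real_derivative - y / E) (at y)"
    using E by (auto intro!: derivative_eq_intros simp: E_def field_simps)
  from DERIV_divide[OF DERIV_cmult_Id[of q] DERIV_cmult[OF this, of p]]
  have "((\<lambda>x. q * x / (p * sqrt (1 - x\<^sup>2))) has_real_derivative
      (q * (p * E) - q * y * (p * (- y / E))) / (p * E * (p * E))) (at y)"
    using E(1) assms(1) by (simp flip: E_def)
  also have "(q * (p * E) - q * y * (p * (- y / E))) / (p * E * (p * E)) = q * (E\<^sup>2 + y\<^sup>2) / (p * E ^ 3)"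
    using E(1) assms by (simp add: field_simps power2_eq_square power3_eq_cube)
  finally have "((\<lambda>x. q * x / (p * sqrt (1 - x\<^sup>2))) has_real_derivative q / (p * E ^ 3)) (at y)"
    by (simp add: E(2))
  from DERIV_chain2[where f = arcsin, OF DERIV_arcsin[of "q * y / (p * sqrt (1 - y\<^sup>2))"] this] a'
  have A: "((\<lambda>x. arcsin (q * x / (p * sqrt (1 - x\<^sup>2)))) has_real_derivative
      inverse (R / (p * E)) * (q / (p * E ^ 3))) (at y)"
    by (simp only: sa flip: E_def)
  have "((\<lambda>x. x / p) has_real_derivative 1 / p) (at y)"
    using assms by (auto intro!: derivative_eq_intros)
  from DERIV_chain2[where f = arcsin, OF DERIV_arcsin[OF b'] this]
  have B: "((\<lambda>x. arcsin (x / p)) has_real_derivative inverse (R / p) * (1 / p)) (at y)"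
    by (simp only: sb)
  have "((\<lambda>x. (arcsin (q * x / (p * sqrt (1 - x\<^sup>2))) - q * arcsin (x / p)) / pi) has_real_derivative
      (inverse (R / (p * E)) * (q / (p * E ^ 3)) - q * (inverse (R / p) * (1 / p))) / pi) (at y)"
    by (intro DERIV_cdivide DERIV_diff A DERIV_cmult B)
  \<comment> \<open>The two terms are \<open>q / (E\<^sup>2 * R)\<close> and \<open>q / R\<close>;
    their difference carries the factor \<open>1 - E\<^sup>2\<close>, which is
    \<open>y\<^sup>2\<close>.\<close>
  moreover have "(inverse (R / (p * E)) * (q / (p * E ^ 3)) - q * (inverse (R / p) * (1 / p))) / pi
      = q * (1 - E\<^sup>2) / (pi * E\<^sup>2 * R)"
    using assms R(1) E(1) by (simp add: field_simps power2_eq_square power3_eq_cube)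
  moreover have "\<dots> = y\<^sup>2 * f_K y p"
    unfolding f_K_def using assms by (simp add: E(2) flip: q_def R_def)
  ultimately show ?thesis by (simp only: q_def f_K_moment2_def[abs_def])
qed

text \<open>The integrand blows up at \<open>p\<close> and \<open>- p\<close>, so differentiability
  is used only in the interior; continuity of the antiderivative covers the end points.\<close>

lemma f_K_moment2_has_integral:
  fixes p a b :: real
  assumes p: "0 < p" "p < 1" and ab: "a \<le> b" "- p \<le> a" "b \<le> p"
  shows "((\<lambda>y. y\<^sup>2 * f_K y p) has_integral f_K_moment2 p b - f_K_moment2 p a) {a..b}"
proof (rule fundamental_theorem_of_calculus_interior[OF ab(1)])
  show "(f_K_moment2 p has_vector_derivative y\<^sup>2 * f_K y p) (at y)" if "y \<in> {a<..<b}" for y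
    using that ab f_K_moment2_has_derivative[OF p, of y]
    unfolding has_real_derivative_iff_has_vector_derivative by auto
  show "continuous_on {a..b} (f_K_moment2 p)"
  proof -
    have p1: "p\<^sup>2 < 1" using p by (simp add: power_less_one_iff)
    have *: "x\<^sup>2 \<le> p\<^sup>2" if "x \<in> {a..b}" for x
      using that ab p by (intro abs_le_square_iff[THEN iffD1]) auto
    \<comment> \<open>Continuity of \<open>arcsin\<close> is available on the closed interval from
      -1 to 1. The argument stays inside it and reaches its ends exactly when \<open>x\<close> is
      \<open>p\<close> or \<open>- p\<close>.\<close>
    have A: "- 1 \<le> sqrt (1 - p\<^sup>2) * x / (p * sqrt (1 - x\<^sup>2)) \<and>
        sqrt (1 - p\<^sup>2) * x / (p * sqrt (1 - x\<^sup>2)) \<le> 1" if "x \<in> {a..b}" for x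
    proof -
      have "sqrt (1 - p\<^sup>2) \<le> sqrt (1 - x\<^sup>2)" "\<bar>x\<bar> \<le> p" "0 < sqrt (1 - x\<^sup>2)"
        using *[OF that] that ab p p1 by auto
      then have "sqrt (1 - p\<^sup>2) * \<bar>x\<bar> \<le> sqrt (1 - x\<^sup>2) * p"
        using p1 by (intro mult_mono) auto
      then have "\<bar>sqrt (1 - p\<^sup>2) * x / (p * sqrt (1 - x\<^sup>2))\<bar> \<le> 1"
        using p p1 \<open>0 < sqrt (1 - x\<^sup>2)\<close> by (simp add: abs_mult divide_le_eq mult.commute)
      then show ?thesis unfolding abs_le_iff by linarith
    qed
    have B: "- 1 \<le> x / p \<and> x / p \<le> 1" if "x \<in> {a..b}" for x
      using that ab p by (simp add: le_divide_eq divide_le_eq)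
    have C: "p * sqrt (1 - x\<^sup>2) \<noteq> 0" if "x \<in> {a..b}" for x
      using *[OF that] p p1 by simp
    have "continuous_on {a..b} (\<lambda>x. arcsin (sqrt (1 - p\<^sup>2) * x / (p * sqrt (1 - x\<^sup>2))))"
      using A C by (intro continuous_on_arcsin continuous_on_divide continuous_intros) blast+
    moreover have "continuous_on {a..b} (\<lambda>x. arcsin (x / p))"
      using B p by (intro continuous_on_arcsin continuous_on_divide continuous_intros) auto
    ultimately show ?thesis
      unfolding f_K_moment2_def
      by (intro continuous_on_divide continuous_on_diff continuous_on_mult continuous_on_const) auto
  qed
qed

lemma f_K_nonneg:
  assumes "0 \<le> p" "p < 1"
  shows "0 \<le> f_K y p"
proof (cases "\<bar>y\<bar> < p")
  case True
  then have "y\<^sup>2 < p\<^sup>2" using assms abs_le_square_iff[of p y] by auto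
  moreover have "p\<^sup>2 < 1" using assms by (simp add: power_less_one_iff)
  ultimately show ?thesis by (simp add: f_K_def)
qed (auto simp: f_K_def abs_less_iff split: split_indicator)

lemma limit_density_integral:
  assumes "0 < \<bar>r\<bar>" "\<bar>r\<bar> < 1" "s \<noteq> 0"
  shows "has_bochner_integral lborel (limit_density s r) (s\<^sup>2 / r\<^sup>2 * (1 - sqrt (1 - r\<^sup>2)))"
proof (rule has_bochner_integral_lborel_nonneg)
  show "limit_density s r \<in> borel_measurable borel"
    unfolding limit_density_def f_K_def by measurable
  show "0 \<le> limit_density s r y" for y
    using f_K_nonneg[of "\<bar>r\<bar>" y] assms(2) by (simp add: limit_density_def)
  \<comment> \<open>The half of the support selected by the sign of \<open>s * r\<close>; outside it
    the density vanishes, so the integral extends to the whole line.\<close>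
  define I where "I = (if s * r > 0 then {0..\<bar>r\<bar>} else {- \<bar>r\<bar>..0})"
  have sr: "s * r \<noteq> 0" using assms by auto
  have r1: "r\<^sup>2 < 1" using assms by (simp add: abs_square_less_1)
  \<comment> \<open>At \<open>\<bar>r\<bar>\<close> both arcsines equal \<open>pi / 2\<close>, and
    the antiderivative is odd.\<close>
  have G: "f_K_moment2 \<bar>r\<bar> 0 = 0" "f_K_moment2 \<bar>r\<bar> \<bar>r\<bar> = (1 - sqrt (1 - r\<^sup>2)) / 2"
    "f_K_moment2 \<bar>r\<bar> (- \<bar>r\<bar>) = - ((1 - sqrt (1 - r\<^sup>2)) / 2)"
    using assms(1) r1 by (simp_all add: f_K_moment2_def field_simps)
  have "((\<lambda>y. y\<^sup>2 * f_K y \<bar>r\<bar>) has_integral (1 - sqrt (1 - r\<^sup>2)) / 2) I"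
    using f_K_moment2_has_integral[OF assms(1,2), of 0 "\<bar>r\<bar>"]
      f_K_moment2_has_integral[OF assms(1,2), of "- \<bar>r\<bar>" 0]
    by (auto simp: I_def G simp del: minus_divide_left)
  from has_integral_mult_right[OF this, of "2 * s\<^sup>2 / r\<^sup>2"]
  have "((\<lambda>y. 2 * s\<^sup>2 / r\<^sup>2 * (y\<^sup>2 * f_K y \<bar>r\<bar>)) has_integral s\<^sup>2 / r\<^sup>2 * (1 - sqrt (1 - r\<^sup>2))) I"
    by simp
  moreover have "2 * s\<^sup>2 / r\<^sup>2 * (y\<^sup>2 * f_K y \<bar>r\<bar>) = limit_density s r y" if "y \<in> I" for y
    using that sr by (auto simp: limit_density_def I_def split: if_splits)
  ultimately have "(limit_density s r has_integral s\<^sup>2 / r\<^sup>2 * (1 - sqrt (1 - r\<^sup>2))) I"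
    by (rule has_integral_eq[rotated])
  then show "(limit_density s r has_integral s\<^sup>2 / r\<^sup>2 * (1 - sqrt (1 - r\<^sup>2))) UNIV"
    by (rule has_integral_on_superset)
       (auto simp: limit_density_def f_K_def I_def split: split_indicator if_splits)
qed

text \<open>As \<open>g\<close> is nonnegative, the signed identity holds where \<open>v\<close>
  increases, that is where \<open>s * r * sin (2 * k) < 0\<close>; where \<open>v\<close> decreases
  a minus sign appears, and the form with \<open>\<bar>deriv v k\<bar>\<close> covers both. At
  \<open>sin k = 0\<close> the value of \<open>v\<close> is an end point of the support, where
  \<open>f_K\<close> is 0 but \<open>(v k)\<^sup>2\<close> is not; at \<open>cos k = 0\<close> the
  phase jumps. Integrability is asserted separately because the integral of a non-integrable
  function is 0 by convention.\<close>

theorem corollary4: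
  fixes \<alpha> \<beta> s r C\<^sub>0 :: real and g v :: "real \<Rightarrow> real"
  assumes "\<alpha> \<in> {0..<2 * pi}" and "\<beta> \<in> {0..<2 * pi}"
    and "s = sin (\<alpha> + \<beta>)" and "s \<noteq> 0"
    and "r = sin (\<alpha> - \<beta>)" and "0 < \<bar>r\<bar>" and "\<bar>r\<bar> < 1"
    and "g = limit_density s r"
    and "C\<^sub>0 = (LINT y|lborel. g y)"
    and "v = group_velocity s r"
  shows "(\<forall>k\<in>{0..<2 * pi}. cos k \<noteq> 0 \<longrightarrow>
            theta0 s r differentiable at k \<and> v differentiable at k)
       \<and> (\<forall>k\<in>{0..<2 * pi}. sin k \<noteq> 0 \<and> cos k \<noteq> 0 \<longrightarrow>
            g (v k) * \<bar>deriv v k\<bar> = (2 * s\<^sup>2 / r\<^sup>2) / pi * (v k)\<^sup>2)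
       \<and> (\<forall>k\<in>{0..<2 * pi}. s * r * sin (2 * k) < 0 \<longrightarrow>
            g (v k) * deriv v k = (2 * s\<^sup>2 / r\<^sup>2) / pi * (v k)\<^sup>2)
       \<and> (\<forall>k\<in>{0..<2 * pi}. s * r * sin (2 * k) > 0 \<longrightarrow>
            g (v k) * deriv v k = - ((2 * s\<^sup>2 / r\<^sup>2) / pi * (v k)\<^sup>2))
       \<and> set_integrable lborel {0..2 * pi} (\<lambda>k. \<bar>v k\<bar> / (2 * pi))
       \<and> (LINT k:{0..2 * pi}|lborel. \<bar>v k\<bar> / (2 * pi)) = 2 * arcsin \<bar>r\<bar> / pi
       \<and> integrable lborel g
       \<and> s\<^sup>2 = r\<^sup>2 / (1 - sqrt (1 - r\<^sup>2)) * C\<^sub>0"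
proof -
  note r0 = assms(6) and r1 = assms(7) and s = assms(4)
  have vel: "g (v k) * \<bar>deriv v k\<bar> = (2 * s\<^sup>2 / r\<^sup>2) / pi * (v k)\<^sup>2" if "sin k \<noteq> 0" "cos k \<noteq> 0" for k
    unfolding assms(8,10) by (rule limit_density_group_velocity[OF r0 r1 s that])
  have up: "g (v k) * deriv v k = (2 * s\<^sup>2 / r\<^sup>2) / pi * (v k)\<^sup>2" if "s * r * sin (2 * k) < 0" for k
  proof -
    have k: "sin k \<noteq> 0" "cos k \<noteq> 0" using that by (auto simp: sin_double)
    have "sgn (deriv v k) = 1"
      using sgn_deriv_group_velocity[OF r1 s k(2)] by (simp only: assms(10) sgn_neg[OF that] minus_minus)
    then have "\<bar>deriv v k\<bar> = deriv v k" by (simp add: sgn_1_pos)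
    then show ?thesis using vel[OF k] by simp
  qed
  have down: "g (v k) * deriv v k = - ((2 * s\<^sup>2 / r\<^sup>2) / pi * (v k)\<^sup>2)" if "s * r * sin (2 * k) > 0" for k
  proof -
    have k: "sin k \<noteq> 0" "cos k \<noteq> 0" using that by (auto simp: sin_double)
    have "sgn (deriv v k) = - 1"
      using sgn_deriv_group_velocity[OF r1 s k(2)] by (simp only: assms(10) sgn_pos[OF that])
    then have "\<bar>deriv v k\<bar> = - deriv v k" by (simp add: sgn_1_neg)
    then show ?thesis using vel[OF k] by simp
  qed
  have diff: "theta0 s r differentiable at k \<and> v differentiable at k" if "cos k \<noteq> 0" for k
    using theta0_has_derivative[OF r1 s that] group_velocity_has_derivative[OF r1 s that]
    by (auto simp: assms(10) real_differentiable_def)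
  note int = limit_density_integral[OF r0 r1 s, folded assms(8)]
  have "C\<^sub>0 = s\<^sup>2 / r\<^sup>2 * (1 - sqrt (1 - r\<^sup>2))"
    unfolding assms(9) by (rule has_bochner_integral_integral_eq[OF int])
  moreover have "1 - sqrt (1 - r\<^sup>2) \<noteq> 0" using r0 by simp
  ultimately have C: "s\<^sup>2 = r\<^sup>2 / (1 - sqrt (1 - r\<^sup>2)) * C\<^sub>0" using r0 by simp
  have "integrable lborel g"
    using int by (simp add: has_bochner_integral_iff)
  moreover note abs_group_velocity_integral[OF r1 s, folded assms(10)]
  ultimately show ?thesis
    using diff vel up down C by (intro conjI ballI impI) blast+
qed

end
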